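(* Let $G$ be a finite, simple, connected graph and let $R$ be a retract of $G$. Then $c_{cr}(R)\leq c_{cr}(G)$.
   Context: An induced subgraph $R$ of a graph $G$ is a retract of $G$ if there is a retraction map $f:V(G)\rightarrow V(R)$ such that (i) if $x$ and $y$ are adjacent in $G$ then $f(x)$ and $f(y)$ are adjacent or $f(x)=f(y)$, and (ii) $f(x)=x$ for all $x\in V(R)$. Cheating Robot game on a finite, simple, connected graph $G$ with $k$ cops: first the cop player places $k$ cops on vertices of $G$, then the robot is placed on a vertex. A vertex may hold more than one token. Play then proceeds in rounds: in each round, first every cop moves to a vertex in its closed neighbourhood (so a cop may stay put), and then the robot, knowing the cops' moves, moves to a vertex in his closed neighbourhood (he may stay put). Both sides have perfect information about positions. The robot is captured if either (i) at the end of the robot's move a cop and the robot are on the same vertex, or (ii) on his move the robot traverses an edge that a cop traversed on the cops' immediately preceding move. (A cop moving onto the robot's vertex does not by itself end the game; the robot still gets his move.) The cops win if they capture the robot after finitely many rounds. $c_{cr}(G)$ is the least number of cops that have a strategy guaranteeing capture of the robot on $G$. *)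

theory Defs
  imports "Graph_Theory.Digraph_Component"
begin

text \<open>
  A finite simple graph is an instance of the locale \<^locale>\<open>graph\<close>: each undirected edge is
  represented by its two arcs, so \<open>u \<rightarrow>\<^bsub>G\<^esub> v\<close> is (symmetric) adjacency. The library's
  \<open>connected\<close> includes nonemptiness of the vertex set.
\<close>

definition closed_nbhd :: "('a, 'b) pre_digraph \<Rightarrow> 'a \<Rightarrow> 'a set" where
  "closed_nbhd G v = insert v {w. v \<rightarrow>\<^bsub>G\<^esub> w}"

definition retraction_map ::
  "('a, 'b) pre_digraph \<Rightarrow> ('a, 'b) pre_digraph \<Rightarrow> ('a \<Rightarrow> 'a) \<Rightarrow> bool" where
  "retraction_map G R f \<longleftrightarrow>
     f ` verts G \<subseteq> verts R \<and>
     (\<forall>x y. x \<rightarrow>\<^bsub>G\<^esub> y \<longrightarrow> f x \<rightarrow>\<^bsub>R\<^esub> f y \<or> f x = f y) \<and>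
     (\<forall>x \<in> verts R. f x = x)"

definition retract :: "('a, 'b) pre_digraph \<Rightarrow> ('a, 'b) pre_digraph \<Rightarrow> bool" where
  "retract R G \<longleftrightarrow> induced_subgraph R G \<and> (\<exists>f. retraction_map G R f)"

text \<open>
  A strategy for the cops maps the list of all robot positions so far to the next position of
  each cop; the empty list gives the initial placement. The cops' own earlier positions need not
  be an argument, since the strategy together with the robot's positions determines them.
  Cops are numbered \<open>0, \<dots>, k - 1\<close>; values of the placement at other numbers are irrelevant.
\<close>

type_synonym 'a cop_strategy = "'a list \<Rightarrow> nat \<Rightarrow> 'a"

text \<open>
  Time \<open>0\<close> is the situation after both initial placements, time \<open>n\<close> the one after \<open>n\<close> rounds.
  The cops' positions at time \<open>n\<close> depend on the robot's positions at times \<open>0, \<dots>, n - 1\<close> only,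
  whereas the robot's move in each round is made after that of the cops.
\<close>

definition cops_at :: "'a cop_strategy \<Rightarrow> (nat \<Rightarrow> 'a) \<Rightarrow> nat \<Rightarrow> nat \<Rightarrow> 'a" where
  "cops_at \<sigma> r n = \<sigma> (map r [0..<n])"

text \<open>
  The robot's moves are recorded as an infinite sequence; moves after a capture are irrelevant.
  As the cops' strategy is fixed, quantifying over all such sequences covers every way in which
  the robot may respond to the cops' moves.
\<close>

definition robot_walk :: "('a, 'b) pre_digraph \<Rightarrow> (nat \<Rightarrow> 'a) \<Rightarrow> bool" where
  "robot_walk G r \<longleftrightarrow> r 0 \<in> verts G \<and> (\<forall>n. r (Suc n) \<in> closed_nbhd G (r n))"

definition legal_strategy :: "('a, 'b) pre_digraph \<Rightarrow> nat \<Rightarrow> 'a cop_strategy \<Rightarrow> bool" where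
  "legal_strategy G k \<sigma> \<longleftrightarrow>
     (\<forall>i<k. \<sigma> [] i \<in> verts G) \<and>
     (\<forall>r. robot_walk G r \<longrightarrow>
       (\<forall>n. \<forall>i<k. cops_at \<sigma> r (Suc n) i \<in> closed_nbhd G (cops_at \<sigma> r n i)))"

text \<open>
  Capture in the round that leads from time \<open>n\<close> to time \<open>Suc n\<close>, where \<open>C\<close> gives the cops'
  positions: a cop ends on the robot's vertex, or the robot traverses (in either direction) an
  edge just traversed by a cop. Sharing a vertex before the robot's move is not a capture.
\<close>

definition captured :: "nat \<Rightarrow> (nat \<Rightarrow> nat \<Rightarrow> 'a) \<Rightarrow> (nat \<Rightarrow> 'a) \<Rightarrow> nat \<Rightarrow> bool" where
  "captured k C r n \<longleftrightarrow>
     (\<exists>i<k. C (Suc n) i = r (Suc n) \<or>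
       (C n i \<noteq> C (Suc n) i \<and> {C n i, C (Suc n) i} = {r n, r (Suc n)}))"

definition winning_strategy :: "('a, 'b) pre_digraph \<Rightarrow> nat \<Rightarrow> 'a cop_strategy \<Rightarrow> bool" where
  "winning_strategy G k \<sigma> \<longleftrightarrow>
     legal_strategy G k \<sigma> \<and> (\<forall>r. robot_walk G r \<longrightarrow> (\<exists>n. captured k (cops_at \<sigma> r) r n))"

definition c_cr :: "('a, 'b) pre_digraph \<Rightarrow> nat" where
  "c_cr G = (LEAST k. \<exists>\<sigma>. winning_strategy G k \<sigma>)"

text \<open>The minimum is taken over a nonempty set: a stationary cop on every vertex wins.\<close>

lemma winning_strategy_exists:
  assumes "graph G"
  shows "\<exists>k \<sigma>. winning_strategy G k \<sigma>"
proof -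
  interpret graph G by fact
  obtain h where h: "bij_betw h {0..<card (verts G)} (verts G)"
    using ex_bij_betw_nat_finite finite_verts by blast
  have "winning_strategy G (card (verts G)) (\<lambda>_. h)"
    unfolding winning_strategy_def legal_strategy_def
  proof (intro conjI allI impI)
    show "h i \<in> verts G" if "i < card (verts G)" for i
      using that h by (auto simp: bij_betw_def)
    show "cops_at (\<lambda>_. h) r (Suc n) i \<in> closed_nbhd G (cops_at (\<lambda>_. h) r n i)" for r n i
      by (simp add: cops_at_def closed_nbhd_def)
    show "\<exists>n. captured (card (verts G)) (cops_at (\<lambda>_. h) r) r n" if "robot_walk G r" for r
    proof -
      have "r (Suc 0) \<in> verts G"
        using that unfolding robot_walk_def closed_nbhd_def by (metis adj_in_verts(2) insertE mem_Collect_eq)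
      then obtain i where "i < card (verts G)" "h i = r (Suc 0)"
        using h unfolding bij_betw_def by (metis atLeastLessThan_iff imageE)
      then show ?thesis
        unfolding captured_def cops_at_def by blast
    qed
  qed
  then show ?thesis by blast
qed

end

theory Submission
  imports Defs
begin

text \<open>
  Let \<open>f\<close> be a retraction of \<open>G\<close> onto \<open>R\<close>. A walk of the robot in \<open>R\<close> is also a walk in \<open>G\<close>, so a
  winning cop strategy \<open>\<sigma>\<close> on \<open>G\<close> can be played against it in imagination; on \<open>R\<close> each cop occupies
  the image under \<open>f\<close> of the position that \<open>\<sigma>\<close> gives. These shadows move legally, because \<open>f\<close> maps
  edges to edges or single vertices. When \<open>\<sigma>\<close> captures the robot, the vertex at
  which a cop meets him, or both ends of the edge on which a cop meets him, are positions of the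
  robot, hence lie in \<open>R\<close> and are fixed by \<open>f\<close>,
  so the shadow captures the robot in the same round, and in the same way. Thus a win with \<open>k\<close> cops on
  \<open>G\<close> gives a win with \<open>k\<close> cops on \<open>R\<close>.
\<close>

lemma closed_nbhd_subgraph_mono:
  assumes "subgraph R G"
  shows "closed_nbhd R v \<subseteq> closed_nbhd G v"
  using assms by (auto simp: closed_nbhd_def dest: arcs_ends_mono)

lemma robot_walk_subgraph:
  assumes "robot_walk R r" and "subgraph R G"
  shows "robot_walk G r"
  using assms closed_nbhd_subgraph_mono[OF assms(2)]
  by (auto simp: robot_walk_def subgraph_def)

lemma robot_walk_in_verts:
  assumes "wf_digraph G" and "robot_walk G r"
  shows "r n \<in> verts G"
proof -
  interpret wf_digraph G by fact
  show ?thesis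
  proof (induction n)
    case 0
    then show ?case
      using assms(2) by (simp add: robot_walk_def)
  next
    case (Suc n)
    have "r (Suc n) \<in> closed_nbhd G (r n)"
      using assms(2) by (simp add: robot_walk_def)
    with Suc show ?case
      by (auto simp: closed_nbhd_def dest: adj_in_verts)
  qed
qed

lemma retraction_map_closed_nbhd:
  assumes "retraction_map G R f" and "w \<in> closed_nbhd G v"
  shows "f w \<in> closed_nbhd R (f v)"
  using assms unfolding retraction_map_def closed_nbhd_def by (metis insert_iff mem_Collect_eq)

lemma winning_strategy_retraction:
  assumes sub: "subgraph R G" and f: "retraction_map G R f" and win: "winning_strategy G k \<sigma>"
  shows "winning_strategy R k (\<lambda>rs i. f (\<sigma> rs i))"
proof -
  let ?\<tau> = "\<lambda>rs i. f (\<sigma> rs i)"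
  have shadow: "cops_at ?\<tau> r n i = f (cops_at \<sigma> r n i)" for r n i
    by (simp add: cops_at_def)
  have "\<sigma> [] i \<in> verts G" if "i < k" for i
    using win that by (simp add: winning_strategy_def legal_strategy_def)
  then have start: "?\<tau> [] i \<in> verts R" if "i < k" for i
    using f that by (auto simp: retraction_map_def)
  have move: "cops_at ?\<tau> r (Suc n) i \<in> closed_nbhd R (cops_at ?\<tau> r n i)"
    if "robot_walk R r" "i < k" for r n i
    unfolding shadow
    using win that robot_walk_subgraph[OF that(1) sub]
    by (intro retraction_map_closed_nbhd[OF f]) (simp add: winning_strategy_def legal_strategy_def)
  have capture: "\<exists>n. captured k (cops_at ?\<tau> r) r n" if walk: "robot_walk R r" for r
  proof -
    have "wf_digraph R"
      using sub by (simp add: subgraph_def)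
    then have fixed: "f (r n) = r n" for n
      using f robot_walk_in_verts[OF _ walk] by (simp add: retraction_map_def)
    obtain n where "captured k (cops_at \<sigma> r) r n"
      using win robot_walk_subgraph[OF walk sub] by (auto simp: winning_strategy_def)
    then have "captured k (cops_at ?\<tau> r) r n"
      unfolding captured_def shadow by (metis doubleton_eq_iff fixed)
    then show ?thesis ..
  qed
  show ?thesis
    using start move capture by (simp add: winning_strategy_def legal_strategy_def)
qed

theorem theorem3p3:
  fixes G R :: "('a, 'b) pre_digraph"
  assumes "graph G"
    and "connected G"
    and "retract R G"
  shows "c_cr R \<le> c_cr G"
proof -
  obtain f where f: "retraction_map G R f" and sub: "subgraph R G"
    using assms(3) by (auto simp: retract_def induced_subgraph_def)
  have "\<exists>\<sigma>. winning_strategy G (c_cr G) \<sigma>"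
    unfolding c_cr_def by (rule LeastI_ex) (rule winning_strategy_exists[OF assms(1)])
  then have "\<exists>\<tau>. winning_strategy R (c_cr G) \<tau>"
    using winning_strategy_retraction[OF sub f] by blast
  then show ?thesis
    unfolding c_cr_def[of R] by (rule Least_le)
qed

end
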